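(* Let $X^\ast\in\mathbb{R}^{N\times(2+d)}$ be the minimizer of $$\min_{X\in\mathbb{R}^{N\times(2+d)}}\ \frac{1}{2\alpha}\|X-\overline{U}\|_F^2+\iota_{\Lambda_1}(X)+\iota_{\Lambda_2}(X),$$ where $\alpha>0$, $\overline{U}\in\mathbb{R}^{N\times(2+d)}$ is the matrix of cell averages of a numerical (discontinuous Galerkin) solution, and $\Lambda_1,\Lambda_2$ are the conservation and invariant-domain constraint sets defined in the context. Let $\overline{U^{\mathrm{exact}}}\in\mathbb{R}^{N\times(2+d)}$ be the matrix of cell averages of an exact solution, all of whose rows (transposed) belong to $G^\varepsilon$, i.e. $\overline{U^{\mathrm{exact}}}\in\Lambda_2$. Suppose that the numerical solution has the same integrals over the whole domain as the exact solution, i.e. $A\overline{U}=A\overline{U^{\mathrm{exact}}}$, and that the numerical cell averages violate the invariant domain, i.e. $\overline{U}\notin\Lambda_2$. Then $$\|X^\ast-\overline{U^{\mathrm{exact}}}\|_F<\|\overline{U}-\overline{U^{\mathrm{exact}}}\|_F .$$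
   Context: Let $d\ge 1$ be the space dimension, $N\ge 1$ the number of cells of a uniform mesh (all cells have equal volume), and $\varepsilon>0$. The numerical admissible set is $$G^\varepsilon=\Big\{[\rho,m^{T},E]^{T}\in\mathbb{R}^{2+d}:\ \rho\in\mathbb{R},\ m\in\mathbb{R}^d,\ E\in\mathbb{R},\ \rho\ge\varepsilon,\ E-\frac{\|m\|_2^2}{2\rho}\ge\varepsilon\Big\},$$ which is a closed convex set. The $i$-th row of a matrix of cell averages stores the average over the $i$-th cell of density, the $d$ momentum components, and total energy. Let $A=[1,1,\dots,1]\in\mathbb{R}^{1\times N}$ and $b^{T}=A\overline{U}\in\mathbb{R}^{1\times(2+d)}$. Define $$\Lambda_1=\{X\in\mathbb{R}^{N\times(2+d)}: AX=b^{T}\},\qquad \Lambda_2=\{X\in\mathbb{R}^{N\times(2+d)}: \text{for every } i,\ \text{the transpose of the } i\text{-th row of } X \text{ lies in } G^\varepsilon\}.$$ For a closed convex set $\Lambda$, $\iota_\Lambda(X)=0$ if $X\in\Lambda$ and $+\infty$ otherwise. $\|\cdot\|_F$ is the Frobenius norm. The minimization problem is strongly convex, so its minimizer is unique. *)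

theory Defs
  imports "HOL-Analysis.Analysis"
begin

text \<open>Column labels of the matrices: \<open>\<real>\<^sup>2\<^sup>+\<^sup>d\<close> is \<open>real ^ 'd conserved\<close> with \<open>d = CARD('d)\<close>.\<close>

datatype 'd conserved = Density | Momentum 'd | Energy

lemma UNIV_conserved: "UNIV = insert Density (insert Energy (range Momentum))"
proof -
  have "c \<in> insert Density (insert Energy (range Momentum))" for c :: "'d conserved"
    by (cases c) auto
  then show ?thesis by blast
qed

instance conserved :: (finite) finite
  by standard (simp add: UNIV_conserved)

definition state :: "real \<Rightarrow> real ^ 'd \<Rightarrow> real \<Rightarrow> real ^ 'd::finite conserved" where
  "state \<rho> m E = (\<chi> c. case c of Density \<Rightarrow> \<rho> | Momentum k \<Rightarrow> m $ k | Energy \<Rightarrow> E)"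

definition admissible :: "real \<Rightarrow> (real ^ 'd::finite conserved) set" where
  "admissible \<epsilon> = {state \<rho> m E | \<rho> m E. \<rho> \<ge> \<epsilon> \<and> E - (norm m)\<^sup>2 / (2 * \<rho>) \<ge> \<epsilon>}"

definition ones_row :: "real ^ 'n::finite ^ 1" where
  "ones_row = (\<chi> i j. 1)"

definition conservation_set ::
  "real ^ 'd::finite conserved ^ 1 \<Rightarrow> (real ^ 'd conserved ^ 'n::finite) set" where
  "conservation_set b = {X. ones_row ** X = b}"

definition invariant_domain_set :: "real \<Rightarrow> (real ^ 'd::finite conserved ^ 'n::finite) set" where
  "invariant_domain_set \<epsilon> = {X. \<forall>i. row i X \<in> admissible \<epsilon>}"

definition convex_indicator :: "'a set \<Rightarrow> 'a \<Rightarrow> ereal" where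
  "convex_indicator S x = (if x \<in> S then 0 else \<infinity>)"

definition frobenius_norm :: "real ^ 'm::finite ^ 'n::finite \<Rightarrow> real" where
  "frobenius_norm X = sqrt (\<Sum>i\<in>UNIV. \<Sum>j\<in>UNIV. (X $ i $ j)\<^sup>2)"

lemma frobenius_norm_eq_norm: "frobenius_norm X = norm X"
  by (simp add: frobenius_norm_def norm_vec_def L2_set_def sum_nonneg)

definition limiter_objective ::
  "real \<Rightarrow> real \<Rightarrow> real ^ 'd::finite conserved ^ 'n::finite \<Rightarrow> real ^ 'd conserved ^ 'n \<Rightarrow> ereal" where
  "limiter_objective \<alpha> \<epsilon> U X =
     ereal (1 / (2 * \<alpha>) * (frobenius_norm (X - U))\<^sup>2)
     + convex_indicator (conservation_set (ones_row ** U)) X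
     + convex_indicator (invariant_domain_set \<epsilon>) X"

end

theory Submission
  imports Defs
begin

text \<open>
  The minimizer is the Euclidean projection of \<open>U\<close> onto the feasible set, the intersection of
  the two constraint sets, and the exact averages are themselves a feasible point.  Projecting onto
  a convex set makes an obtuse angle: if \<open>x\<close> is nearest to \<open>u\<close> and \<open>y\<close> is any other point of the
  set, then \<open>(u - x) \<bullet> (y - x) \<le> 0\<close>, whence
  \<open>\<parallel>u - y\<parallel>\<^sup>2 \<ge> \<parallel>u - x\<parallel>\<^sup>2 + \<parallel>x - y\<parallel>\<^sup>2\<close>.  The gain \<open>\<parallel>u - x\<parallel>\<^sup>2\<close> is positive because \<open>U\<close>
  violates the invariant domain (\<open>dist_nearest_point_less\<close>).

  What has to be checked about the problem at hand is that the feasible set is convex.  The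
  conservation constraint is affine.  The admissible states form an intersection of half-spaces
  (\<open>mem_admissible_iff\<close>), since the kinetic energy is a supremum of linear functions of
  density and momentum.
\<close>

text \<open>
  If the angle at \<open>x\<close> were acute, a short step from \<open>x\<close> towards \<open>y\<close> would stay in the set and come
  closer to \<open>u\<close>.
\<close>

lemma dist_nearest_point_less:
  fixes u x y :: "'a::euclidean_space"
  assumes "convex S" "x \<in> S" "y \<in> S" "u \<notin> S"
    and nearest: "\<And>z. z \<in> S \<Longrightarrow> dist x u \<le> dist z u"
  shows "dist x y < dist u y"
proof -
  have obtuse: "(u - x) \<bullet> (y - x) \<le> 0"
  proof (rule ccontr)
    assume "\<not> (u - x) \<bullet> (y - x) \<le> 0"
    then obtain t where t: "t > 0" "t \<le> 1" "dist (x + t *\<^sub>R (y - x)) u < dist x u"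
      using closer_point_lemma[of u x y] by auto
    have "x + t *\<^sub>R (y - x) = (1 - t) *\<^sub>R x + t *\<^sub>R y"
      by (simp add: algebra_simps)
    also have "\<dots> \<in> S"
      using \<open>convex S\<close> \<open>x \<in> S\<close> \<open>y \<in> S\<close> t by (simp add: convex_alt)
    finally show False
      using nearest t(3) by fastforce
  qed
  have "(norm (u - y))\<^sup>2 = (norm (u - x))\<^sup>2 + (norm (x - y))\<^sup>2 - 2 * ((u - x) \<bullet> (y - x))"
    unfolding power2_norm_eq_inner by (simp add: inner_diff inner_commute)
  moreover have "(norm (u - x))\<^sup>2 > 0"
    using \<open>x \<in> S\<close> \<open>u \<notin> S\<close> by auto
  ultimately have "(norm (x - y))\<^sup>2 < (norm (u - y))\<^sup>2"
    using obtuse by linarith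
  then show ?thesis
    unfolding dist_norm by (rule power2_less_imp_less) simp
qed

definition momentum :: "real ^ 'd::finite conserved \<Rightarrow> real ^ 'd" where
  "momentum x = (\<chi> k. x $ Momentum k)"

lemma momentum_add: "momentum (x + y) = momentum x + momentum y"
  by (simp add: momentum_def vec_eq_iff)

lemma momentum_scaleR: "momentum (c *\<^sub>R x) = c *\<^sub>R momentum x"
  by (simp add: momentum_def vec_eq_iff)

lemma state_components:
  "state \<rho> m E $ Density = \<rho>" "momentum (state \<rho> m E) = m" "state \<rho> m E $ Energy = E"
  by (simp_all add: state_def momentum_def vec_eq_iff)

lemma state_of_components: "state (x $ Density) (momentum x) (x $ Energy) = x"
  by (simp add: state_def momentum_def vec_eq_iff split: conserved.split)

lemma mem_admissible:
  "x \<in> admissible \<epsilon> \<longleftrightarrow>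
     \<epsilon> \<le> x $ Density \<and> \<epsilon> \<le> x $ Energy - (norm (momentum x))\<^sup>2 / (2 * x $ Density)"
proof
  assume "x \<in> admissible \<epsilon>"
  then show "\<epsilon> \<le> x $ Density \<and> \<epsilon> \<le> x $ Energy - (norm (momentum x))\<^sup>2 / (2 * x $ Density)"
    by (auto simp: admissible_def state_components)
next
  assume "\<epsilon> \<le> x $ Density \<and> \<epsilon> \<le> x $ Energy - (norm (momentum x))\<^sup>2 / (2 * x $ Density)"
  then show "x \<in> admissible \<epsilon>"
    unfolding admissible_def using state_of_components[of x, symmetric] by blast
qed

text \<open>
  Completing the square in \<open>v\<close>: the kinetic energy dominates the right-hand side, which is linear
  in \<open>(\<rho>, m)\<close>, and the defect vanishes at the velocity \<open>v = m / \<rho>\<close>.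
\<close>

lemma kinetic_energy_eq:
  fixes m v :: "'a::real_inner"
  assumes "\<rho> > 0"
  shows "(norm m)\<^sup>2 / (2 * \<rho>) - (norm (m - \<rho> *\<^sub>R v))\<^sup>2 / (2 * \<rho>) = m \<bullet> v - (norm v)\<^sup>2 / 2 * \<rho>"
proof -
  have "(norm (m - \<rho> *\<^sub>R v))\<^sup>2 = (norm m)\<^sup>2 - 2 * \<rho> * (m \<bullet> v) + \<rho>\<^sup>2 * (norm v)\<^sup>2"
    unfolding power2_norm_eq_inner
    by (simp add: inner_diff_left inner_diff_right inner_commute[of v m] power2_eq_square
        algebra_simps)
  then show ?thesis
    using assms by (simp add: field_simps power2_eq_square)
qed

text \<open>
  Each inequality on the right is linear in the state, so convexity can be read off, whereas the
  defining condition is a quotient.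
\<close>

lemma mem_admissible_iff:
  assumes "\<epsilon> > 0"
  shows "x \<in> admissible \<epsilon> \<longleftrightarrow>
    \<epsilon> \<le> x $ Density \<and>
    (\<forall>v. \<epsilon> \<le> x $ Energy - momentum x \<bullet> v + (norm v)\<^sup>2 / 2 * x $ Density)"
    (is "_ \<longleftrightarrow> ?R")
proof
  assume "x \<in> admissible \<epsilon>"
  then have dens: "\<epsilon> \<le> x $ Density"
    and ener: "\<epsilon> \<le> x $ Energy - (norm (momentum x))\<^sup>2 / (2 * x $ Density)"
    by (simp_all add: mem_admissible)
  have "\<epsilon> \<le> x $ Energy - momentum x \<bullet> v + (norm v)\<^sup>2 / 2 * x $ Density" for v
  proof -
    have "(norm (momentum x - x $ Density *\<^sub>R v))\<^sup>2 / (2 * x $ Density) \<ge> 0"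
      using dens \<open>\<epsilon> > 0\<close> by simp
    then show ?thesis
      using kinetic_energy_eq[of "x $ Density" "momentum x" v] dens ener \<open>\<epsilon> > 0\<close>
      by linarith
  qed
  with dens show ?R by blast
next
  assume ?R
  define v where "v = (1 / x $ Density) *\<^sub>R momentum x"
  have "x $ Density > 0"
    using \<open>?R\<close> \<open>\<epsilon> > 0\<close> by linarith
  have "momentum x - x $ Density *\<^sub>R v = 0"
    using \<open>x $ Density > 0\<close> by (simp add: v_def)
  then have "(norm (momentum x))\<^sup>2 / (2 * x $ Density)
      = momentum x \<bullet> v - (norm v)\<^sup>2 / 2 * x $ Density"
    using kinetic_energy_eq[OF \<open>x $ Density > 0\<close>, of "momentum x" v] by simp
  moreover have "\<epsilon> \<le> x $ Energy - momentum x \<bullet> v + (norm v)\<^sup>2 / 2 * x $ Density"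
    using \<open>?R\<close> by blast
  ultimately show "x \<in> admissible \<epsilon>"
    using \<open>?R\<close> unfolding mem_admissible by linarith
qed

lemma convex_admissible:
  assumes "\<epsilon> > 0"
  shows "convex (admissible \<epsilon> :: (real ^ 'd::finite conserved) set)"
proof (rule convexI)
  fix x y :: "real ^ 'd conserved" and s t :: real
  assume x: "x \<in> admissible \<epsilon>" and y: "y \<in> admissible \<epsilon>"
    and st: "0 \<le> s" "0 \<le> t" "s + t = 1"
  have combine: "\<epsilon> \<le> s * a + t * b" if "\<epsilon> \<le> a" "\<epsilon> \<le> b" for a b
    using convex_bound_le[of "- a" "- \<epsilon>" "- b" s t] that st by simp
  have "\<epsilon> \<le> (s *\<^sub>R x + t *\<^sub>R y) $ Energy - momentum (s *\<^sub>R x + t *\<^sub>R y) \<bullet> v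
            + (norm v)\<^sup>2 / 2 * (s *\<^sub>R x + t *\<^sub>R y) $ Density" for v
  proof -
    have "\<epsilon> \<le> s * (x $ Energy - momentum x \<bullet> v + (norm v)\<^sup>2 / 2 * x $ Density)
            + t * (y $ Energy - momentum y \<bullet> v + (norm v)\<^sup>2 / 2 * y $ Density)"
      using x y \<open>\<epsilon> > 0\<close> by (intro combine) (simp_all add: mem_admissible_iff)
    then show ?thesis
      by (simp add: momentum_add momentum_scaleR inner_add_left algebra_simps)
  qed
  moreover have "\<epsilon> \<le> (s *\<^sub>R x + t *\<^sub>R y) $ Density"
    using x y combine by (simp add: mem_admissible)
  ultimately show "s *\<^sub>R x + t *\<^sub>R y \<in> admissible \<epsilon>"
    using \<open>\<epsilon> > 0\<close> by (simp add: mem_admissible_iff)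
qed

lemma convex_invariant_domain_set:
  assumes "\<epsilon> > 0"
  shows "convex (invariant_domain_set \<epsilon> :: (real ^ 'd::finite conserved ^ 'n::finite) set)"
proof (rule convexI)
  fix X Y :: "real ^ 'd conserved ^ 'n" and s t :: real
  assume "X \<in> invariant_domain_set \<epsilon>" "Y \<in> invariant_domain_set \<epsilon>"
    and "0 \<le> s" "0 \<le> t" "s + t = 1"
  moreover have "row i (s *\<^sub>R X + t *\<^sub>R Y) = s *\<^sub>R row i X + t *\<^sub>R row i Y" for i
    by (simp add: row_def vec_eq_iff)
  ultimately show "s *\<^sub>R X + t *\<^sub>R Y \<in> invariant_domain_set \<epsilon>"
    by (auto simp: invariant_domain_set_def intro!: convexD[OF convex_admissible[OF assms]])
qed

lemma convex_conservation_set: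
  "convex (conservation_set b :: (real ^ 'd::finite conserved ^ 'n::finite) set)"
proof (rule convexI)
  fix X Y :: "real ^ 'd conserved ^ 'n" and s t :: real
  assume "X \<in> conservation_set b" "Y \<in> conservation_set b" and "s + t = 1"
  moreover have "ones_row ** (s *\<^sub>R X + t *\<^sub>R Y) = s *\<^sub>R (ones_row ** X) + t *\<^sub>R (ones_row ** Y)"
    by (simp add: matrix_matrix_mult_def vec_eq_iff sum.distrib sum_distrib_left algebra_simps)
  ultimately show "s *\<^sub>R X + t *\<^sub>R Y \<in> conservation_set b"
    by (simp add: conservation_set_def flip: scaleR_add_left)
qed

lemma limiter_objective_feasible:
  assumes "X \<in> conservation_set (ones_row ** U) \<inter> invariant_domain_set \<epsilon>"
  shows "limiter_objective \<alpha> \<epsilon> U X = ereal (1 / (2 * \<alpha>) * (dist X U)\<^sup>2)"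
  using assms
  by (simp add: limiter_objective_def convex_indicator_def frobenius_norm_eq_norm dist_norm)

lemma limiter_objective_infeasible:
  assumes "X \<notin> conservation_set (ones_row ** U) \<inter> invariant_domain_set \<epsilon>"
  shows "limiter_objective \<alpha> \<epsilon> U X = \<infinity>"
  using assms by (auto simp: limiter_objective_def convex_indicator_def)

text \<open>
  A feasible competitor makes the minimal value finite, which forces the minimizer to be feasible;
  without one, every matrix would be a minimizer with value \<open>\<infinity>\<close>.
\<close>

lemma limiter_minimizer_nearest:
  assumes "\<alpha> > 0"
    and min: "is_arg_min (limiter_objective \<alpha> \<epsilon> U) (\<lambda>X. True) X"
    and Z: "Z \<in> conservation_set (ones_row ** U) \<inter> invariant_domain_set \<epsilon>"
  shows "X \<in> conservation_set (ones_row ** U) \<inter> invariant_domain_set \<epsilon>"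
    and "dist X U \<le> dist Z U"
proof -
  have le: "limiter_objective \<alpha> \<epsilon> U X \<le> limiter_objective \<alpha> \<epsilon> U Z"
    using min by (simp add: is_arg_min_linorder)
  show X: "X \<in> conservation_set (ones_row ** U) \<inter> invariant_domain_set \<epsilon>"
  proof (rule ccontr)
    assume "X \<notin> conservation_set (ones_row ** U) \<inter> invariant_domain_set \<epsilon>"
    from limiter_objective_infeasible[OF this, of \<alpha>] le limiter_objective_feasible[OF Z, of \<alpha>]
    show False by simp
  qed
  have "(dist X U)\<^sup>2 \<le> (dist Z U)\<^sup>2"
    using le \<open>\<alpha> > 0\<close> limiter_objective_feasible[OF X] limiter_objective_feasible[OF Z]
    by (simp add: divide_le_cancel)
  then show "dist X U \<le> dist Z U"
    by (rule power2_le_imp_le) simp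
qed

theorem theorem1:
  fixes U U_exact X_star :: "real ^ 'd::finite conserved ^ 'n::finite"
    and \<alpha> \<epsilon> :: real
  assumes "\<epsilon> > 0"
    and "\<alpha> > 0"
    and "is_arg_min (limiter_objective \<alpha> \<epsilon> U) (\<lambda>X. True) X_star"
    and "U_exact \<in> invariant_domain_set \<epsilon>"
    and "(ones_row :: real ^ 'n ^ 1) ** U = ones_row ** U_exact"
    and "U \<notin> invariant_domain_set \<epsilon>"
  shows "frobenius_norm (X_star - U_exact) < frobenius_norm (U - U_exact)"
proof -
  let ?S = "conservation_set (ones_row ** U) \<inter> invariant_domain_set \<epsilon>"
  have exact: "U_exact \<in> ?S"
    using assms(4,5) by (simp add: conservation_set_def)
  have "dist X_star U_exact < dist U U_exact"
  proof (rule dist_nearest_point_less)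
    show "convex ?S"
      using convex_conservation_set convex_invariant_domain_set[OF assms(1)] by (rule convex_Int)
    show "X_star \<in> ?S"
      using limiter_minimizer_nearest(1)[OF assms(2,3) exact] .
    show "U_exact \<in> ?S" by (fact exact)
    show "U \<notin> ?S" using assms(6) by simp
    show "dist X_star U \<le> dist Z U" if "Z \<in> ?S" for Z
      using limiter_minimizer_nearest(2)[OF assms(2,3) that] .
  qed
  then show ?thesis
    by (simp add: frobenius_norm_eq_norm dist_norm)
qed

end
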